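(* Let $\mathcal{G}$ be the class of all finite graphs, and let $CH\mathcal{G}$, $P\mathcal{G}$, $C\mathcal{G}$ and $CP\mathcal{G}$ be the classes of all chordal, permutation, comparability and competitivity graphs, respectively. Then: (i) $C\mathcal{G}\setminus(CP\mathcal{G}\cup CH\mathcal{G})\neq\emptyset$, i.e. there are comparability graphs that are neither competitivity graphs nor chordal graphs. (ii) $CP\mathcal{G}\setminus(C\mathcal{G}\cup CH\mathcal{G})\neq\emptyset$, i.e. there are competitivity graphs that are neither comparability graphs nor chordal graphs. (iii) $\mathcal{G}\setminus(C\mathcal{G}\cup CP\mathcal{G}\cup CH\mathcal{G})\neq\emptyset$, i.e. there are graphs that are neither comparability graphs, nor competitivity graphs, nor chordal graphs. (iv) $P\mathcal{G}=C\mathcal{G}\cap CP\mathcal{G}$, and $P\mathcal{G}\not\subseteq CH\mathcal{G}$, i.e. permutation graphs are exactly the graphs that are both competitivity and comparability graphs, but not every permutation graph is chordal. (v) $CH\mathcal{G}\setminus(C\mathcal{G}\cup CP\mathcal{G})\neq\emptyset$, i.e. there are chordal graphs that are neither comparability graphs nor competitivity graphs. (vi) $CP\mathcal{G}\cap CH\mathcal{G}\cap(\mathcal{G}\setminus C\mathcal{G})\neq\emptyset$, i.e. there are graphs that are both competitivity and chordal but not comparability. (vii) $C\mathcal{G}\cap CH\mathcal{G}\cap(\mathcal{G}\setminus CP\mathcal{G})\neq\emptyset$, i.e. there are graphs that are both comparability and chordal but not competitivity. (viii) $CH\mathcal{G}\cap CP\mathcal{G}\cap C\mathcal{G}\neq\emptyset$,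 i.e. there are graphs that are chordal, competitivity and comparability.
   Context: Graphs are finite, simple, undirected, with nonempty vertex set; membership in each class is understood up to isomorphism (relabeling of the vertices). Competitivity graph: let $\mathcal{N}=\{1,\dots,n\}$ with $n\ge 1$. A ranking of $\mathcal{N}$ is a bijection $c:\mathcal{N}\to\mathcal{N}$, identified with the vector $(c(1),\dots,c(n))$, so that $c^{-1}(i)$ is the position of node $i$. Write $i\prec_c j$ if $c^{-1}(i)<c^{-1}(j)$, i.e. $i$ appears before $j$ in the vector. Given a finite family $\mathcal{R}=\{c_1,\dots,c_r\}$ ($r\ge1$) of rankings of $\mathcal{N}$, nodes $i,j$ compete if there exist $s,t\in\{1,\dots,r\}$ with $i\prec_{c_s}j$ and $j\prec_{c_t}i$. The competitivity graph $G_c(\mathcal{R})$ is the undirected graph with vertex set $\mathcal{N}$ in which $i$ and $j$ are adjacent iff they compete. A graph is a competitivity graph if it is (isomorphic to) $G_c(\mathcal{R})$ for some $n$ and some such family $\mathcal{R}$. Chordal graph: every cycle of four or more vertices has a chord (an edge joining two vertices not adjacent in the cycle). Comparability graph: there is a partial order $\preceq$ on the vertex set such that distinct vertices $i,j$ are adjacent iff $i\preceq j$ or $j\preceq i$. Equivalently, the edges admit a transitive orientation: an orientation such that whenever $(i,j)$ and $(j,k)$ are oriented edges, so is $(i,k)$. Permutation graph: the vertices can be labeled by $1,\dots,n$ so that, for some permutation of $\{1,\dots,n\}$, two vertices are adjacent iff the corresponding pair is reversed (is an inversion) by the permutation. *)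

theory Defs
  imports "Graph_Theory.Graph_Theory" "HOL-Combinatorics.Permutations"
begin

text \<open>
  A finite simple undirected graph is a \<^locale>\<open>pair_graph\<close>: a finite, loop-free digraph whose arc
  relation is symmetric, so an edge between \<open>u\<close> and \<open>v\<close> is the pair of arcs \<open>(u,v)\<close>, \<open>(v,u)\<close>.
  The vertices are natural numbers, so that the classes below are sets; every finite graph is
  isomorphic to a graph of this form.
\<close>

definition graphs :: "nat pair_pre_digraph set" where
  "graphs = {G. pair_graph G \<and> pverts G \<noteq> {}}"


text \<open>
  A ranking \<open>c\<close> of \<open>{1..n}\<close> is a function with \<open>c permutes {1..n}\<close>, where \<open>c k\<close> is the node at
  position \<open>k\<close> and \<open>inv c i\<close> is the position of node \<open>i\<close>.
\<close>

definition precedes :: "(nat \<Rightarrow> nat) \<Rightarrow> nat \<Rightarrow> nat \<Rightarrow> bool" where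
  "precedes c i j \<longleftrightarrow> inv c i < inv c j"

definition compete :: "(nat \<Rightarrow> nat) set \<Rightarrow> nat \<Rightarrow> nat \<Rightarrow> bool" where
  "compete R i j \<longleftrightarrow> (\<exists>s\<in>R. \<exists>t\<in>R. precedes s i j \<and> precedes t j i)"

definition Gc :: "nat \<Rightarrow> (nat \<Rightarrow> nat) set \<Rightarrow> nat pair_pre_digraph" where
  "Gc n R = \<lparr> pverts = {1..n}, parcs = {(i, j). i \<in> {1..n} \<and> j \<in> {1..n} \<and> compete R i j} \<rparr>"

definition competitivity_graphs :: "nat pair_pre_digraph set" where
  "competitivity_graphs = {G \<in> graphs. \<exists>n R. n \<ge> 1 \<and> finite R \<and> R \<noteq> {} \<and>
     (\<forall>c\<in>R. c permutes {1..n}) \<and> digraph_iso (with_proj (Gc n R)) (with_proj G)}"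


text \<open>
  A cycle is given by its list of arcs, so its vertices are the tails of these arcs, and two vertices
  are adjacent in the cycle iff an arc between them, in either direction, occurs in the list.
\<close>

definition has_chord :: "nat pair_pre_digraph \<Rightarrow> (nat \<times> nat) list \<Rightarrow> bool" where
  "has_chord G p \<longleftrightarrow> (\<exists>u \<in> fst ` set p. \<exists>v \<in> fst ` set p.
     (u, v) \<in> parcs G \<and> (u, v) \<notin> set p \<and> (v, u) \<notin> set p)"

definition chordal_graphs :: "nat pair_pre_digraph set" where
  "chordal_graphs = {G \<in> graphs.
     \<forall>p. pre_digraph.cycle (with_proj G) p \<and> length p \<ge> 4 \<longrightarrow> has_chord G p}"


definition comparability_graphs :: "nat pair_pre_digraph set" where
  "comparability_graphs = {G \<in> graphs. \<exists>r. partial_order_on (pverts G) r \<and>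
     (\<forall>i\<in>pverts G. \<forall>j\<in>pverts G. i \<noteq> j \<longrightarrow> ((i, j) \<in> parcs G \<longleftrightarrow> (i, j) \<in> r \<or> (j, i) \<in> r))}"


definition inversion :: "(nat \<Rightarrow> nat) \<Rightarrow> nat \<Rightarrow> nat \<Rightarrow> bool" where
  "inversion \<pi> a b \<longleftrightarrow> a < b \<and> \<pi> b < \<pi> a \<or> b < a \<and> \<pi> a < \<pi> b"

definition permutation_graphs :: "nat pair_pre_digraph set" where
  "permutation_graphs = {G \<in> graphs. \<exists>n l \<pi>. bij_betw l (pverts G) {1..n} \<and> \<pi> permutes {1..n} \<and>
     (\<forall>u\<in>pverts G. \<forall>v\<in>pverts G. (u, v) \<in> parcs G \<longleftrightarrow> inversion \<pi> (l u) (l v))}"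

end

theory Submission
  imports Defs
begin

text \<open>
  The eight claims reduce to questions about comparability graphs and their complements. Two nodes
  that do not compete are ordered in the same way by all rankings, so the common order of the
  rankings is a partial order whose incomparable pairs are the competing ones. Conversely, every
  finite partial order is the intersection of its linear extensions: an incomparable pair can be
  put in either order before the rest is sorted topologically. Hence a graph is a competitivity
  graph iff its complement is a comparability graph
  (\<open>competitivity_iff_complement_comparability\<close>).

  Permutation graphs are then the graphs that are transitively orientable together with their
  complement. If \<open>r\<close> orients \<open>G\<close> and \<open>s\<close> orients its complement, then \<open>r \<union> s\<close> and \<open>r\<inverse> \<union> s\<close> are
  both linear orders, and they disagree exactly on the edges of \<open>G\<close>. Numbering the vertices along
  the first and reading off their positions in the second gives the permutation
  (\<open>permutation_eq_comparability_Int_competitivity\<close>).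

  For the strictness claims, each witness is certified by finite data. Transitive orientability is
  shown by an orientation and refuted by an odd closed walk in which the two neighbours of each
  vertex on the walk are non-adjacent or equal: passing such a vertex reverses the orientation, which
  is impossible an odd number of times around (\<open>odd_closed_walk_not_comparability\<close>). Chordality is
  shown by an elimination order (\<open>perfect_elimination_order_chordal\<close>) and refuted by an induced
  cycle. The witnesses are the cycles with four, five and six vertices, the complement of the
  six-cycle, the net, the subdivided claw, an interval graph on seven vertices and the one-vertex
  graph.
\<close>

section \<open>Graphs, complements and transitive orientations\<close>

text \<open>
  The set \<open>D\<close> picks one direction for each edge. For a comparability graph it is taken to be a
  transitive orientation, so that the graph carries its own certificate.
\<close>

definition sym_graph :: "nat \<Rightarrow> (nat \<times> nat) set \<Rightarrow> nat pair_pre_digraph" where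
  "sym_graph n D = \<lparr> pverts = {..<n}, parcs = D \<union> D\<inverse> \<rparr>"

definition complement :: "'a pair_pre_digraph \<Rightarrow> 'a pair_pre_digraph" where
  "complement G = \<lparr> pverts = pverts G,
     parcs = {(u, v). u \<in> pverts G \<and> v \<in> pverts G \<and> u \<noteq> v \<and> (u, v) \<notin> parcs G} \<rparr>"

text \<open>
  The orientation is a reflexive order, so that the edges point along its strict part.
\<close>

definition transitively_orients :: "('a \<times> 'a) set \<Rightarrow> 'a pair_pre_digraph \<Rightarrow> bool" where
  "transitively_orients r G \<longleftrightarrow> partial_order_on (pverts G) r \<and>
     (\<forall>i\<in>pverts G. \<forall>j\<in>pverts G. i \<noteq> j \<longrightarrow> ((i, j) \<in> parcs G \<longleftrightarrow> (i, j) \<in> r \<or> (j, i) \<in> r))"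

lemma comparability_graphs_iff:
  "G \<in> comparability_graphs \<longleftrightarrow> G \<in> graphs \<and> (\<exists>r. transitively_orients r G)"
  by (auto simp: comparability_graphs_def transitively_orients_def)

lemma graphs_iff:
  "G \<in> graphs \<longleftrightarrow> finite (pverts G) \<and> pverts G \<noteq> {} \<and> parcs G \<subseteq> pverts G \<times> pverts G \<and>
     sym (parcs G) \<and> irrefl (parcs G)"
proof
  assume "G \<in> graphs"
  then have pg: "pair_graph G" and ne: "pverts G \<noteq> {}"
    by (auto simp: graphs_def)
  interpret pair_graph G by (rule pg)
  show "finite (pverts G) \<and> pverts G \<noteq> {} \<and> parcs G \<subseteq> pverts G \<times> pverts G \<and>
     sym (parcs G) \<and> irrefl (parcs G)"
    using ne pair_finite_verts pair_sym_arcs pair_no_loops in_arcsD1 in_arcsD2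
    by (fastforce simp: irrefl_def symmetric_def)
next
  assume a: "finite (pverts G) \<and> pverts G \<noteq> {} \<and> parcs G \<subseteq> pverts G \<times> pverts G \<and>
     sym (parcs G) \<and> irrefl (parcs G)"
  then have "finite (parcs G)"
    by (meson finite_SigmaI finite_subset)
  with a have "pair_graph G"
    by unfold_locales (auto simp: irrefl_def symmetric_def)
  with a show "G \<in> graphs" by (simp add: graphs_def)
qed

lemma sym_graph_simps [simp]:
  "pverts (sym_graph n D) = {..<n}"
  "parcs (sym_graph n D) = D \<union> D\<inverse>"
  by (simp_all add: sym_graph_def)

lemma sym_graph_in_graphs:
  assumes "0 < n" "\<forall>(u, v) \<in> D. u < n \<and> v < n \<and> u \<noteq> v"
  shows "sym_graph n D \<in> graphs"
  using assms by (fastforce simp: graphs_iff sym_def irrefl_def)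

lemma pverts_complement [simp]: "pverts (complement G) = pverts G"
  by (simp add: complement_def)

lemma parcs_complement:
  "(u, v) \<in> parcs (complement G) \<longleftrightarrow>
     u \<in> pverts G \<and> v \<in> pverts G \<and> u \<noteq> v \<and> (u, v) \<notin> parcs G"
  by (simp add: complement_def)

lemma complement_in_graphs: "G \<in> graphs \<Longrightarrow> complement G \<in> graphs"
  by (auto simp: graphs_iff complement_def sym_def irrefl_def)

lemma complement_complement: "G \<in> graphs \<Longrightarrow> complement (complement G) = G"
  by (rule pair_pre_digraph.equality) (auto simp: graphs_iff complement_def irrefl_def)

lemma sym_graph_comparability:
  assumes n: "0 < n" and arcs: "\<forall>(u, v) \<in> D. u < n \<and> v < n \<and> u \<noteq> v" and tr: "trans D"
  shows "sym_graph n D \<in> comparability_graphs"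
proof -
  have D: "D \<subseteq> {..<n} \<times> {..<n}" using arcs by auto
  have as: "\<And>x y. (x, y) \<in> D \<Longrightarrow> (y, x) \<notin> D"
    using tr arcs by (blast dest: transD)
  have "transitively_orients (D \<union> Id_on {..<n}) (sym_graph n D)"
    unfolding transitively_orients_def partial_order_on_def preorder_on_def
  proof (intro conjI)
    show "refl_on (pverts (sym_graph n D)) (D \<union> Id_on {..<n})"
      using D by (auto simp: refl_on_def)
    show "trans (D \<union> Id_on {..<n})"
      using tr by (auto simp: trans_def)
    show "antisym (D \<union> Id_on {..<n})"
      using as by (auto simp: antisym_def)
  qed (use D in auto)
  then show ?thesis
    using sym_graph_in_graphs[OF n arcs] unfolding comparability_graphs_iff by blast
qed

section \<open>Linear extensions\<close>

text \<open>
  Topological sorting: a finite acyclic relation has a maximal element, which takes the last number.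
\<close>

lemma topological_numbering:
  assumes "finite S" "acyclic r"
  shows "\<exists>l. bij_betw l S {1..card S} \<and> (\<forall>x\<in>S. \<forall>y\<in>S. (x, y) \<in> r \<longrightarrow> l x < l y)"
  using assms(1)
proof (induction "card S" arbitrary: S)
  case 0
  then show ?case by (auto simp: bij_betw_def)
next
  case (Suc n)
  let ?q = "r \<inter> S \<times> S"
  have "finite ?q" using Suc.prems by auto
  moreover have "acyclic ?q" using assms(2) by (rule acyclic_subset) auto
  ultimately have wf: "wf (?q\<inverse>)" by (rule finite_acyclic_wf_converse)
  obtain z where "z \<in> S" using Suc.hyps(2) by fastforce
  then obtain m where m: "m \<in> S" "\<And>y. (y, m) \<in> ?q\<inverse> \<Longrightarrow> y \<notin> S"
    using wfE_min[OF wf] by metis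
  then have mmax: "\<And>y. y \<in> S \<Longrightarrow> (m, y) \<notin> r" by blast
  have cS: "card S = Suc n" using Suc.hyps(2) by (rule sym)
  then have c: "n = card (S - {m})" by (simp add: m(1))
  obtain l where l: "bij_betw l (S - {m}) {1..n}"
      and mono: "\<And>x y. \<lbrakk>x \<in> S - {m}; y \<in> S - {m}; (x, y) \<in> r\<rbrakk> \<Longrightarrow> l x < l y"
    using Suc.hyps(1)[of "S - {m}"] c Suc.prems by auto
  let ?l = "l(m := Suc n)"
  have bij': "bij_betw ?l (S - {m}) {1..n}"
    using l by (rule bij_betw_cong[THEN iffD1, rotated]) auto
  have "bij_betw ?l (insert m (S - {m})) (insert (Suc n) {1..n})"
    using notIn_Un_bij_betw[of m "S - {m}" ?l "{1..n}"] bij' by simp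
  then have b: "bij_betw ?l S {1..card S}"
    using m(1) by (simp add: cS insert_absorb atLeastAtMostSuc_conv)
  have "?l x < ?l y" if "x \<in> S" "y \<in> S" "(x, y) \<in> r" for x y
  proof -
    have "x \<noteq> m" using mmax[OF that(2)] that(3) by blast
    moreover from this have "l x \<le> n" using l that(1) by (force simp: bij_betw_def)
    ultimately show ?thesis using mono that by (cases "y = m") auto
  qed
  with b show ?case by blast
qed

lemma permutation_between_numberings:
  assumes "bij_betw l V A" "bij_betw l' V A"
  shows "\<exists>\<pi>. \<pi> permutes A \<and> (\<forall>x\<in>V. \<pi> (l x) = l' x)"
proof -
  let ?p = "\<lambda>i. if i \<in> A then l' (inv_into V l i) else i"
  have "bij_betw (l' \<circ> inv_into V l) A A"
    using assms bij_betw_inv_into bij_betw_trans by blast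
  then have "bij_betw ?p A A"
    by (rule bij_betw_cong[THEN iffD1, rotated]) auto
  then have "?p permutes A" by (rule bij_imp_permutes) auto
  moreover have "\<forall>x\<in>V. ?p (l x) = l' x"
    using assms(1) by (auto simp: bij_betw_def)
  ultimately show ?thesis by blast
qed

text \<open>
  These two facts make it possible to force an incomparable pair into either order: adding one arc
  to an acyclic relation closes a cycle only if the reverse of the arc is already in the reflexive
  transitive closure.
\<close>

lemma partial_order_on_strict_rtrancl:
  assumes "partial_order_on V r"
  shows "(r - Id)\<^sup>* \<subseteq> r \<union> Id" "acyclic (r - Id)"
proof -
  have tr: "trans r" and an: "antisym r"
    using assms by (auto simp: partial_order_on_def preorder_on_def)
  have "(r - Id)\<^sup>* \<subseteq> r\<^sup>*" by (rule rtrancl_mono) auto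
  also have "\<dots> \<subseteq> r \<union> Id" using tr by (auto simp: rtrancl_eq_or_trancl)
  finally show "(r - Id)\<^sup>* \<subseteq> r \<union> Id" .
  have "trans (r - Id)" using tr an by (auto simp: trans_def antisym_def)
  then show "acyclic (r - Id)" by (simp add: acyclic_def)
qed

section \<open>Competitivity graphs are the complements of comparability graphs\<close>

text \<open>
  An isomorphism carries independent maps on vertices and arcs. Without parallel arcs the arc map is
  determined by the vertex map, so that isomorphism is a bijection of the vertices which preserves
  and reflects adjacency.
\<close>

lemma digraph_iso_with_proj_iff:
  assumes "parcs H \<subseteq> pverts H \<times> pverts H" "parcs G \<subseteq> pverts G \<times> pverts G"
  shows "digraph_iso (with_proj H) (with_proj G) \<longleftrightarrow>
    (\<exists>f. bij_betw f (pverts H) (pverts G) \<and>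
      (\<forall>i\<in>pverts H. \<forall>j\<in>pverts H. (i, j) \<in> parcs H \<longleftrightarrow> (f i, f j) \<in> parcs G))"
proof
  assume "digraph_iso (with_proj H) (with_proj G)"
  then obtain h where h: "pre_digraph.digraph_isomorphism (with_proj H) h"
     "with_proj G = app_iso h (with_proj H)"
    by (auto simp: digraph_iso_def)
  have eqs: "pverts G = iso_verts h ` pverts H" "parcs G = iso_arcs h ` parcs H"
    "fst = iso_tail h" "snd = iso_head h"
    using arg_cong[OF h(2), of verts] arg_cong[OF h(2), of arcs]
      arg_cong[OF h(2), of tail] arg_cong[OF h(2), of head] by simp_all
  have inj: "inj_on (iso_verts h) (pverts H)"
    and arc: "\<And>a. a \<in> parcs H \<Longrightarrow> iso_arcs h a = (iso_verts h (fst a), iso_verts h (snd a))"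
    using h(1) by (auto simp: pre_digraph.digraph_isomorphism_def eqs(3,4)[symmetric] prod_eq_iff)
  have "(i, j) \<in> parcs H" if "i \<in> pverts H" "j \<in> pverts H"
    "(iso_verts h i, iso_verts h j) \<in> parcs G" for i j
  proof -
    from that(3) obtain a where a: "a \<in> parcs H"
      "(iso_verts h i, iso_verts h j) = (iso_verts h (fst a), iso_verts h (snd a))"
      using arc by (auto simp: eqs(2))
    then have "i = fst a" "j = snd a"
      using that(1,2) assms(1) inj_on_eq_iff[OF inj] by force+
    with a(1) show ?thesis by simp
  qed
  moreover have "(iso_verts h i, iso_verts h j) \<in> parcs G" if "(i, j) \<in> parcs H" for i j
    using arc[OF that] that by (force simp: eqs(2))
  ultimately show "\<exists>f. bij_betw f (pverts H) (pverts G) \<and>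
      (\<forall>i\<in>pverts H. \<forall>j\<in>pverts H. (i, j) \<in> parcs H \<longleftrightarrow> (f i, f j) \<in> parcs G)"
    using inj eqs(1) by (intro exI[of _ "iso_verts h"]) (auto simp: bij_betw_def)
next
  assume "\<exists>f. bij_betw f (pverts H) (pverts G) \<and>
      (\<forall>i\<in>pverts H. \<forall>j\<in>pverts H. (i, j) \<in> parcs H \<longleftrightarrow> (f i, f j) \<in> parcs G)"
  then obtain f where f: "inj_on f (pverts H)" "pverts G = f ` pverts H"
     "\<And>i j. \<lbrakk>i \<in> pverts H; j \<in> pverts H\<rbrakk> \<Longrightarrow> (i, j) \<in> parcs H \<longleftrightarrow> (f i, f j) \<in> parcs G"
    by (auto simp: bij_betw_def)
  let ?h = "\<lparr>iso_verts = f, iso_arcs = map_prod f f, iso_head = snd, iso_tail = fst\<rparr>"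
  have "wf_digraph (with_proj H)"
    using assms(1) by unfold_locales auto
  moreover have "inj_on (map_prod f f) (parcs H)"
    using map_prod_inj_on[OF f(1) f(1)] assms(1) by (rule inj_on_subset)
  ultimately have "pre_digraph.digraph_isomorphism (with_proj H) ?h"
    using f(1) by (simp add: pre_digraph.digraph_isomorphism_def)
  moreover have "map_prod f f ` parcs H = parcs G"
  proof (rule set_eqI, rule iffI)
    fix e assume "e \<in> map_prod f f ` parcs H"
    then show "e \<in> parcs G" using f(3) assms(1) by auto
  next
    fix e assume e: "e \<in> parcs G"
    then have "e \<in> f ` pverts H \<times> f ` pverts H" using assms(2) f(2) by blast
    then obtain i j where ij: "e = (f i, f j)" "i \<in> pverts H" "j \<in> pverts H" by blast
    with e f(3) show "e \<in> map_prod f f ` parcs H" by force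
  qed
  then have "with_proj G = app_iso ?h (with_proj H)"
    using f(2) by (simp add: app_iso_def with_proj_def)
  ultimately show "digraph_iso (with_proj H) (with_proj G)"
    by (auto simp: digraph_iso_def)
qed

lemma competitivity_graphs_numbering_iff:
  "G \<in> competitivity_graphs \<longleftrightarrow> G \<in> graphs \<and>
    (\<exists>n R g. finite R \<and> R \<noteq> {} \<and> (\<forall>c\<in>R. c permutes {1..n}) \<and> bij_betw g (pverts G) {1..n} \<and>
      (\<forall>u\<in>pverts G. \<forall>v\<in>pverts G. (u, v) \<in> parcs G \<longleftrightarrow> compete R (g u) (g v)))"
  (is "?L \<longleftrightarrow> _ \<and> ?R")
proof (cases "G \<in> graphs")
  case True
  have wfG: "parcs G \<subseteq> pverts G \<times> pverts G" and ne: "pverts G \<noteq> {}"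
    using True by (auto simp: graphs_iff)
  have iso: "digraph_iso (with_proj (Gc n R)) (with_proj G) \<longleftrightarrow>
    (\<exists>f. bij_betw f {1..n} (pverts G) \<and>
      (\<forall>i\<in>{1..n}. \<forall>j\<in>{1..n}. compete R i j \<longleftrightarrow> (f i, f j) \<in> parcs G))" for n R
    by (subst digraph_iso_with_proj_iff) (use wfG in \<open>auto simp: Gc_def\<close>)
  show ?thesis
  proof
    assume ?L
    then obtain n R where R: "finite R" "R \<noteq> {}" "\<forall>c\<in>R. c permutes {1..n}"
      and "digraph_iso (with_proj (Gc n R)) (with_proj G)"
      unfolding competitivity_graphs_def by blast
    then obtain f where f: "bij_betw f {1..n} (pverts G)"
      and e: "\<And>i j. \<lbrakk>i \<in> {1..n}; j \<in> {1..n}\<rbrakk> \<Longrightarrow> compete R i j \<longleftrightarrow> (f i, f j) \<in> parcs G"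
      unfolding iso by blast
    let ?g = "inv_into {1..n} f"
    have g: "bij_betw ?g (pverts G) {1..n}" using f by (rule bij_betw_inv_into)
    have "(u, v) \<in> parcs G \<longleftrightarrow> compete R (?g u) (?g v)" if "u \<in> pverts G" "v \<in> pverts G" for u v
    proof -
      have "?g u \<in> {1..n}" "?g v \<in> {1..n}" using g that by (auto simp: bij_betw_def)
      moreover have "f (?g u) = u" "f (?g v) = v"
        using f that by (auto simp: bij_betw_inv_into_right)
      ultimately show ?thesis using e by metis
    qed
    then show "G \<in> graphs \<and> ?R" using R g True by blast
  next
    assume "G \<in> graphs \<and> ?R"
    then obtain n R g where R: "finite R" "R \<noteq> {}" "\<forall>c\<in>R. c permutes {1..n}"
      and g: "bij_betw g (pverts G) {1..n}"
      and e: "\<And>u v. \<lbrakk>u \<in> pverts G; v \<in> pverts G\<rbrakk> \<Longrightarrow> (u, v) \<in> parcs G \<longleftrightarrow> compete R (g u) (g v)"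
      by blast
    let ?f = "inv_into (pverts G) g"
    have f: "bij_betw ?f {1..n} (pverts G)" using g by (rule bij_betw_inv_into)
    have "compete R i j \<longleftrightarrow> (?f i, ?f j) \<in> parcs G" if "i \<in> {1..n}" "j \<in> {1..n}" for i j
    proof -
      have "?f i \<in> pverts G" "?f j \<in> pverts G" using f that by (auto simp: bij_betw_def)
      moreover have "g (?f i) = i" "g (?f j) = j"
        using g that by (auto simp: bij_betw_inv_into_right)
      ultimately show ?thesis using e by metis
    qed
    moreover have "n \<ge> 1" using g ne by (auto simp: bij_betw_def)
    moreover from calculation(1) have "digraph_iso (with_proj (Gc n R)) (with_proj G)"
      using f unfolding iso by blast
    ultimately show ?L
      using True R unfolding competitivity_graphs_def by blast
  qed
qed (auto simp: competitivity_graphs_def)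

text \<open>
  The order is the intersection of the rankings. Since there is at least one ranking, it is
  antisymmetric.
\<close>

lemma competitivity_imp_complement_comparability:
  assumes "G \<in> competitivity_graphs"
  shows "complement G \<in> comparability_graphs"
proof -
  obtain n R g where G: "G \<in> graphs"
    and R: "R \<noteq> {}" "\<forall>c\<in>R. c permutes {1..n}"
    and bij: "bij_betw g (pverts G) {1..n}"
    and e: "\<forall>u\<in>pverts G. \<forall>v\<in>pverts G. (u, v) \<in> parcs G \<longleftrightarrow> compete R (g u) (g v)"
    using assms unfolding competitivity_graphs_numbering_iff by (elim conjE exE)
  have g: "inj_on g (pverts G)" using bij by (rule bij_betw_imp_inj_on)
  have pos: "inv c (g u) = inv c (g v) \<longleftrightarrow> u = v"
    if "c \<in> R" "u \<in> pverts G" "v \<in> pverts G" for c u v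
    using R(2)[rule_format, OF that(1)] g that(2,3)
    by (metis inj_onD permutes_inv permutes_inj injD)
  define r where "r = {(u, v). u \<in> pverts G \<and> v \<in> pverts G \<and> (\<forall>c\<in>R. inv c (g u) \<le> inv c (g v))}"
  have "transitively_orients r (complement G)"
    unfolding transitively_orients_def partial_order_on_def preorder_on_def
  proof (intro conjI)
    show "refl_on (pverts (complement G)) r" by (auto simp: refl_on_def r_def)
    show "r \<subseteq> pverts (complement G) \<times> pverts (complement G)" by (auto simp: r_def)
    show "trans r" by (force simp: trans_def r_def)
    show "antisym r" using R(1) pos by (fastforce simp: antisym_def r_def)
    show "\<forall>i\<in>pverts (complement G). \<forall>j\<in>pverts (complement G). i \<noteq> j \<longrightarrow>
      ((i, j) \<in> parcs (complement G)) = ((i, j) \<in> r \<or> (j, i) \<in> r)"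
    proof (intro ballI impI)
      fix i j assume ij: "i \<in> pverts (complement G)" "j \<in> pverts (complement G)" "i \<noteq> j"
      have "(i, j) \<in> parcs (complement G) \<longleftrightarrow> \<not> compete R (g i) (g j)"
        using ij e by (simp add: parcs_complement)
      also have "\<dots> \<longleftrightarrow> (i, j) \<in> r \<or> (j, i) \<in> r"
        using ij pos unfolding compete_def precedes_def r_def
        by (simp add: linorder_not_less) (metis nat_less_le linorder_not_less)
      finally show "(i, j) \<in> parcs (complement G) \<longleftrightarrow> (i, j) \<in> r \<or> (j, i) \<in> r" .
    qed
  qed
  then show ?thesis using G by (auto simp: comparability_graphs_iff complement_in_graphs)
qed

text \<open>
  The family consists of all linear extensions of the order on the complement. Comparable vertices
  then never compete, and incomparable ones do because each of the two ways to order them extends to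
  a linear extension.
\<close>

lemma complement_comparability_imp_competitivity:
  assumes "G \<in> graphs" "complement G \<in> comparability_graphs"
  shows "G \<in> competitivity_graphs"
proof -
  define V where "V = pverts G"
  have fin: "finite V" and irr: "\<And>u. (u, u) \<notin> parcs G"
    using assms(1) by (auto simp: V_def graphs_iff irrefl_def)
  obtain r where po: "partial_order_on V r"
    and r: "\<And>i j. \<lbrakk>i \<in> V; j \<in> V; i \<noteq> j\<rbrakk> \<Longrightarrow> (i, j) \<notin> parcs G \<longleftrightarrow> (i, j) \<in> r \<or> (j, i) \<in> r"
    using assms(2)
    by (auto simp: comparability_graphs_iff transitively_orients_def parcs_complement V_def)
  have rV: "r \<subseteq> V \<times> V" using po by (auto simp: partial_order_on_def preorder_on_def)
  note strict = partial_order_on_strict_rtrancl[OF po]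
  obtain g where g: "bij_betw g V {1..card V}"
    using topological_numbering[OF fin strict(2)] by blast
  let ?N = "{1..card V}"
  \<comment> \<open>The numbering \<open>g\<close> names the vertices as nodes and is arbitrary. The rankings below are
    the linear extensions, transported along it.\<close>
  define R where "R = {c. c permutes ?N \<and> (\<forall>(u, v) \<in> r - Id. inv c (g u) < inv c (g v))}"
  have ranking: "\<exists>c\<in>R. \<forall>u\<in>V. \<forall>v\<in>V. (u, v) \<in> q \<longrightarrow> inv c (g u) < inv c (g v)"
    if q: "acyclic q" "r - Id \<subseteq> q" for q
  proof -
    obtain l where l: "bij_betw l V ?N" and mono: "\<And>u v. \<lbrakk>u \<in> V; v \<in> V; (u, v) \<in> q\<rbrakk> \<Longrightarrow> l u < l v"
      using topological_numbering[OF fin q(1)] by blast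
    obtain c where c: "c permutes ?N" "\<And>u. u \<in> V \<Longrightarrow> c (l u) = g u"
      using permutation_between_numberings[OF l g] by blast
    have i: "inv c (g u) = l u" if "u \<in> V" for u
      using permutes_inverses(2)[OF c(1)] c(2)[OF that] by metis
    have "inv c (g u) < inv c (g v)" if "(u, v) \<in> r - Id" for u v
    proof -
      have "u \<in> V" "v \<in> V" "(u, v) \<in> q" using that q(2) rV by auto
      then show ?thesis using mono i by simp
    qed
    then have "c \<in> R" using c(1) by (auto simp: R_def)
    then show ?thesis using i mono by (intro bexI[of _ c]) simp_all
  qed
  have "finite R" by (rule finite_subset[OF _ finite_permutations[of ?N]]) (auto simp: R_def)
  moreover have "R \<noteq> {}" using ranking[OF strict(2)] by auto
  moreover have "(u, v) \<in> parcs G \<longleftrightarrow> compete R (g u) (g v)" if uv: "u \<in> V" "v \<in> V" for u v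
  proof (cases "u = v")
    case True
    then show ?thesis using irr by (auto simp: compete_def precedes_def)
  next
    case False
    show ?thesis
    proof
      assume "(u, v) \<in> parcs G"
      then have inc: "(u, v) \<notin> r" "(v, u) \<notin> r" using r[OF uv False] by auto
      \<comment> \<open>Each of the two directions of an incomparable pair can be added to the order.\<close>
      have "acyclic (insert (u, v) (r - Id))" "acyclic (insert (v, u) (r - Id))"
        using strict inc False by (auto simp: acyclic_insert)
      from this[THEN ranking] obtain s t where
        "s \<in> R" "inv s (g u) < inv s (g v)" "t \<in> R" "inv t (g v) < inv t (g u)"
        using uv by blast
      then show "compete R (g u) (g v)" by (auto simp: compete_def precedes_def)
    next
      assume "compete R (g u) (g v)"
      then obtain s t where st: "s \<in> R" "t \<in> R" "inv s (g u) < inv s (g v)" "inv t (g v) < inv t (g u)"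
        by (auto simp: compete_def precedes_def)
      have agree: "inv c (g a) < inv c (g b)" if "c \<in> R" "(a, b) \<in> r" "a \<noteq> b" for a b c
        using that by (auto simp: R_def)
      have "(u, v) \<notin> r" "(v, u) \<notin> r"
        using agree[OF st(2), of u v] agree[OF st(1), of v u] st(3,4) False by auto
      then show "(u, v) \<in> parcs G" using r[OF uv False] by blast
    qed
  qed
  ultimately show ?thesis
    using assms(1) g unfolding competitivity_graphs_numbering_iff V_def[symmetric]
    by (intro conjI exI[of _ "card V"] exI[of _ R] exI[of _ g]) (auto simp: R_def)
qed

theorem competitivity_iff_complement_comparability:
  "G \<in> competitivity_graphs \<longleftrightarrow> G \<in> graphs \<and> complement G \<in> comparability_graphs"
proof -
  have "competitivity_graphs \<subseteq> graphs" by (auto simp: competitivity_graphs_def)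
  then show ?thesis
    using competitivity_imp_complement_comparability complement_comparability_imp_competitivity
    by blast
qed

section \<open>Permutation graphs\<close>

text \<open>
  The non-inverted pairs are those ordered alike by two linear orders, and the inverted pairs those
  ordered alike once one of the two is reversed. Both are intersections of two linear orders.
\<close>

lemma permutation_imp_comparability:
  assumes "G \<in> permutation_graphs"
  shows "G \<in> comparability_graphs" "complement G \<in> comparability_graphs"
proof -
  obtain n l \<pi> where G: "G \<in> graphs" and l: "inj_on l (pverts G)" and \<pi>: "\<pi> permutes {1..n}"
    and e: "\<And>u v. \<lbrakk>u \<in> pverts G; v \<in> pverts G\<rbrakk> \<Longrightarrow> (u, v) \<in> parcs G \<longleftrightarrow> inversion \<pi> (l u) (l v)"
    using assms by (auto simp: permutation_graphs_def bij_betw_def)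
  have inj: "\<pi> (l u) = \<pi> (l v) \<longleftrightarrow> u = v" "l u = l v \<longleftrightarrow> u = v"
    if "u \<in> pverts G" "v \<in> pverts G" for u v
    using l that permutes_inj[OF \<pi>] by (auto dest: injD inj_onD)
  define r where "r = {(u, v). u \<in> pverts G \<and> v \<in> pverts G \<and> l u \<le> l v \<and> \<pi> (l v) \<le> \<pi> (l u)}"
  define s where "s = {(u, v). u \<in> pverts G \<and> v \<in> pverts G \<and> l u \<le> l v \<and> \<pi> (l u) \<le> \<pi> (l v)}"
  have "partial_order_on (pverts G) r"
    using inj by (auto simp: partial_order_on_def preorder_on_def refl_on_def trans_def antisym_def r_def)
  moreover have "(u, v) \<in> parcs G \<longleftrightarrow> (u, v) \<in> r \<or> (v, u) \<in> r"
    if "u \<in> pverts G" "v \<in> pverts G" "u \<noteq> v" for u v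
    using that inj[of u v] e by (auto simp: r_def inversion_def)
  ultimately have "transitively_orients r G"
    by (auto simp: transitively_orients_def)
  with G show "G \<in> comparability_graphs" by (auto simp: comparability_graphs_iff)
  have "partial_order_on (pverts G) s"
    using inj by (auto simp: partial_order_on_def preorder_on_def refl_on_def trans_def antisym_def s_def)
  moreover have "(u, v) \<notin> parcs G \<longleftrightarrow> (u, v) \<in> s \<or> (v, u) \<in> s"
    if "u \<in> pverts G" "v \<in> pverts G" "u \<noteq> v" for u v
    using that inj[of u v] e by (auto simp: s_def inversion_def)
  ultimately have "transitively_orients s (complement G)"
    by (auto simp: transitively_orients_def parcs_complement)
  with G show "complement G \<in> comparability_graphs"
    by (auto simp: comparability_graphs_iff complement_in_graphs)
qed

text \<open>
  The union of the two orientations is a tournament, so it is a linear order as soon as it is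
  transitive. Transitivity can fail only for one arc from each relation, \<open>x\<close> to \<open>y\<close> to \<open>z\<close>. Then an
  arc from \<open>z\<close> back to \<open>x\<close> would compose with the arc of its own kind and make \<open>y\<close> both adjacent and
  non-adjacent to \<open>x\<close> or to \<open>z\<close>.
\<close>

lemma orientations_of_complements_numbering:
  assumes G: "finite (pverts G)"
    and r: "transitively_orients r G" and s: "transitively_orients s (complement G)"
  shows "\<exists>l. bij_betw l (pverts G) {1..card (pverts G)} \<and>
    (\<forall>u\<in>pverts G. \<forall>v\<in>pverts G. u \<noteq> v \<longrightarrow> (l u < l v \<longleftrightarrow> (u, v) \<in> r \<union> s))"
proof -
  let ?V = "pverts G"
  have sub: "r \<subseteq> ?V \<times> ?V" "s \<subseteq> ?V \<times> ?V" and tr: "trans r" "trans s"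
    and an: "antisym r" "antisym s"
    using r s by (auto simp: transitively_orients_def partial_order_on_def preorder_on_def)
  have refl: "refl_on ?V r"
    using r by (auto simp: transitively_orients_def partial_order_on_def preorder_on_def)
  have tot: "(u, v) \<in> r \<or> (v, u) \<in> r \<or> (u, v) \<in> s \<or> (v, u) \<in> s"
    if "u \<in> ?V" "v \<in> ?V" "u \<noteq> v" for u v
    using r s that by (auto simp: transitively_orients_def parcs_complement)
  have ex: False if "(u, v) \<in> r \<or> (v, u) \<in> r" "(u, v) \<in> s \<or> (v, u) \<in> s" "u \<noteq> v" for u v
  proof -
    have "u \<in> ?V" "v \<in> ?V" using that(1) sub by auto
    then show ?thesis
      using that r s unfolding transitively_orients_def by (simp add: parcs_complement) metis
  qed
  have mixed: "(x, z) \<in> r \<union> s"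
    if "(x, y) \<in> r \<and> (y, z) \<in> s \<or> (x, y) \<in> s \<and> (y, z) \<in> r" "x \<noteq> y" "y \<noteq> z" for x y z
  proof -
    have V: "x \<in> ?V" "z \<in> ?V" using that(1) sub by auto
    have "x \<noteq> z" using that ex[of x y] by auto
    then consider "(x, z) \<in> r \<union> s" | "(z, x) \<in> r" | "(z, x) \<in> s" using tot[OF V] by auto
    then show ?thesis
    proof cases
      case 2
      have "(x, y) \<in> r \<Longrightarrow> (z, y) \<in> r" "(y, z) \<in> r \<Longrightarrow> (y, x) \<in> r"
        using 2 tr(1) by (meson transD)+
      then show ?thesis using that ex[of x y] ex[of y z] by blast
    next
      case 3
      have "(x, y) \<in> s \<Longrightarrow> (z, y) \<in> s" "(y, z) \<in> s \<Longrightarrow> (y, x) \<in> s"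
        using 3 tr(2) by (meson transD)+
      then show ?thesis using that ex[of x y] ex[of y z] by blast
    qed
  qed
  have trL: "trans (r \<union> s)"
  proof (rule transI)
    fix x y z assume xy: "(x, y) \<in> r \<union> s" and yz: "(y, z) \<in> r \<union> s"
    show "(x, z) \<in> r \<union> s"
      using xy yz mixed[of x y z] tr by (cases "x = y"; cases "y = z") (auto dest: transD)
  qed
  have anL: "antisym (r \<union> s)"
    using an ex by (fastforce simp: antisym_def)
  have "partial_order_on ?V (r \<union> s)"
    using refl sub trL anL by (auto simp: partial_order_on_def preorder_on_def refl_on_def)
  then have "acyclic (r \<union> s - Id)" by (rule partial_order_on_strict_rtrancl)
  from topological_numbering[OF G this] obtain l
    where l: "bij_betw l ?V {1..card ?V}"
      and mono: "\<And>x y. \<lbrakk>x \<in> ?V; y \<in> ?V; (x, y) \<in> r \<union> s - Id\<rbrakk> \<Longrightarrow> l x < l y"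
    by blast
  have "l u < l v \<longleftrightarrow> (u, v) \<in> r \<union> s" if "u \<in> ?V" "v \<in> ?V" "u \<noteq> v" for u v
    using mono[of u v] mono[of v u] tot[OF that] that by auto
  with l show ?thesis by blast
qed

text \<open>
  Reversing the orientation of \<open>G\<close> but not that of the complement gives a second linear order. The
  two orders disagree exactly on the edges, which therefore are the inversions of the permutation
  that leads from the first numbering to the second.
\<close>

lemma comparability_and_complement_imp_permutation:
  assumes "G \<in> comparability_graphs" "complement G \<in> comparability_graphs"
  shows "G \<in> permutation_graphs"
proof -
  let ?V = "pverts G"
  obtain r s where G: "G \<in> graphs" and r: "transitively_orients r G"
    and s: "transitively_orients s (complement G)"
    using assms by (auto simp: comparability_graphs_iff)
  have fin: "finite ?V" and irr: "\<And>u. (u, u) \<notin> parcs G"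
    using G by (auto simp: graphs_iff irrefl_def)
  have r': "transitively_orients (r\<inverse>) G"
    using r unfolding transitively_orients_def partial_order_on_def preorder_on_def
    by (auto simp: refl_on_def)
  obtain l where l: "bij_betw l ?V {1..card ?V}"
    and lo: "\<And>u v. \<lbrakk>u \<in> ?V; v \<in> ?V; u \<noteq> v\<rbrakk> \<Longrightarrow> l u < l v \<longleftrightarrow> (u, v) \<in> r \<union> s"
    using orientations_of_complements_numbering[OF fin r s] by blast
  obtain l' where l': "bij_betw l' ?V {1..card ?V}"
    and lo': "\<And>u v. \<lbrakk>u \<in> ?V; v \<in> ?V; u \<noteq> v\<rbrakk> \<Longrightarrow> l' u < l' v \<longleftrightarrow> (u, v) \<in> r\<inverse> \<union> s"
    using orientations_of_complements_numbering[OF fin r' s] by blast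
  obtain \<pi> where \<pi>: "\<pi> permutes {1..card ?V}" "\<And>u. u \<in> ?V \<Longrightarrow> \<pi> (l u) = l' u"
    using permutation_between_numberings[OF l l'] by blast
  have "(u, v) \<in> parcs G \<longleftrightarrow> inversion \<pi> (l u) (l v)" if uv: "u \<in> ?V" "v \<in> ?V" for u v
  proof (cases "u = v")
    case True
    then show ?thesis using irr by (simp add: inversion_def)
  next
    case False
    have arc: "(u, v) \<in> parcs G \<longleftrightarrow> (u, v) \<in> r \<or> (v, u) \<in> r"
      and narc: "(u, v) \<notin> parcs G \<longleftrightarrow> (u, v) \<in> s \<or> (v, u) \<in> s"
      using r s uv False by (auto simp: transitively_orients_def parcs_complement)
    have "antisym s" using s by (auto simp: transitively_orients_def partial_order_on_def)
    then show ?thesis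
      using arc narc False uv lo[of u v] lo[of v u] lo'[of u v] lo'[of v u] \<pi>(2)
      by (auto simp: inversion_def dest: antisymD)
  qed
  then show ?thesis using G l \<pi>(1) unfolding permutation_graphs_def by blast
qed

theorem permutation_eq_comparability_Int_competitivity:
  "permutation_graphs = comparability_graphs \<inter> competitivity_graphs"
proof -
  have "permutation_graphs \<subseteq> graphs" by (auto simp: permutation_graphs_def)
  then show ?thesis
    using permutation_imp_comparability comparability_and_complement_imp_permutation
      competitivity_iff_complement_comparability
    by blast
qed

section \<open>An obstruction to transitive orientation\<close>

text \<open>
  These are the walks without triangular chords in the characterisation of comparability graphs by
  Gilmore and Hoffman. A walk may turn back: in a loopless graph \<open>(u, u)\<close> is not an arc, so
  \<open>u, v, u\<close> counts as having no triangular chord.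
\<close>

fun untriangulated_walk :: "('a \<times> 'a) set \<Rightarrow> 'a list \<Rightarrow> bool" where
  "untriangulated_walk A (u # v # w # p) \<longleftrightarrow>
     (u, v) \<in> A \<and> (u, w) \<notin> A \<and> untriangulated_walk A (v # w # p)"
| "untriangulated_walk A [u, v] \<longleftrightarrow> (u, v) \<in> A"
| "untriangulated_walk A _ \<longleftrightarrow> False"

text \<open>
  If \<open>u\<close> and \<open>w\<close> are non-adjacent, the edges \<open>uv\<close> and \<open>vw\<close> cannot be oriented in a row, for
  transitivity would then give an edge between \<open>u\<close> and \<open>w\<close>. If \<open>u = w\<close>, antisymmetry excludes it
  in the same way. So the direction of travel alternates along the walk.
\<close>

lemma untriangulated_walk_alternates:
  assumes G: "G \<in> graphs" and r: "transitively_orients r G"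
    and "untriangulated_walk (parcs G) (u # v # p @ [x, y])"
  shows "(u, v) \<in> r \<longleftrightarrow> ((x, y) \<in> r \<longleftrightarrow> even (length p))"
proof -
  have tr: "trans r" and an: "antisym r"
    using r by (auto simp: transitively_orients_def partial_order_on_def preorder_on_def)
  have arc: "u \<noteq> v" "(u, v) \<in> r \<or> (v, u) \<in> r" if "(u, v) \<in> parcs G" for u v
  proof -
    have "u \<in> pverts G" "v \<in> pverts G" and ne: "u \<noteq> v"
      using that G by (auto simp: graphs_iff irrefl_def)
    then show "u \<noteq> v" "(u, v) \<in> r \<or> (v, u) \<in> r"
      using that r unfolding transitively_orients_def by blast+
  qed
  have rV: "u \<in> pverts G" "v \<in> pverts G" if "(u, v) \<in> r" for u v
    using that r by (auto simp: transitively_orients_def partial_order_on_def preorder_on_def)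
  have flip: "(u, v) \<in> r \<longleftrightarrow> (v, w) \<notin> r"
    if "(u, v) \<in> parcs G" "(v, w) \<in> parcs G" "(u, w) \<notin> parcs G" for u v w
  proof -
    have "(u, w) \<notin> r \<or> u = w" "(w, u) \<notin> r \<or> u = w"
      using that(3) r rV[of u w] rV[of w u] unfolding transitively_orients_def by blast+
    then show ?thesis
      using arc[OF that(1)] arc[OF that(2)] tr an by (metis antisymD transD)
  qed
  show ?thesis using assms(3)
  proof (induction p arbitrary: u v)
    case Nil
    then show ?case using flip[of u v x] flip[of v x y] by auto
  next
    case (Cons w p)
    have "(v, w) \<in> parcs G" using Cons.prems by (cases p) auto
    then have "(u, v) \<in> r \<longleftrightarrow> (v, w) \<notin> r" using flip Cons.prems by auto
    moreover have "(v, w) \<in> r \<longleftrightarrow> ((x, y) \<in> r \<longleftrightarrow> even (length p))"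
      using Cons by auto
    ultimately show ?case by auto
  qed
qed

text \<open>
  The closed walk is written out until its first edge is repeated. It has \<open>length p + 2\<close> steps, and
  the alternation makes the first edge point both ways when this number is odd.
\<close>

lemma odd_closed_walk_not_comparability:
  assumes "untriangulated_walk (parcs G) (u # v # p @ [u, v])" "odd (length p)"
  shows "G \<notin> comparability_graphs"
proof
  assume "G \<in> comparability_graphs"
  then obtain r where "G \<in> graphs" "transitively_orients r G"
    unfolding comparability_graphs_iff by blast
  from untriangulated_walk_alternates[OF this assms(1)] show False
    using assms(2) by blast
qed

section \<open>Chordality from a perfect elimination order\<close>

lemma pcas_map: "pcas u p v \<Longrightarrow> map fst p @ [v] = u # map snd p"
  by (induction p arbitrary: u) auto

lemma pawalk_verts_map: "pcas u p v \<Longrightarrow> pawalk_verts u p = u # map snd p"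
  by (induction p arbitrary: u) auto

text \<open>
  This and the next two lemmas give the connectivity of a cycle: the arcs of a closed walk cannot
  leave vertices behind, so a nonempty set of its vertices that is closed under successors
  contains all of them. A cycle of length at least four therefore does not contain a shorter one.
\<close>

lemma pcas_successor_closed:
  assumes "pcas u p v" "u \<in> S" "\<And>x y. \<lbrakk>(x, y) \<in> set p; x \<in> S\<rbrakk> \<Longrightarrow> y \<in> S"
  shows "v \<in> S \<and> fst ` set p \<subseteq> S"
  using assms
proof (induction p arbitrary: u)
  case (Cons e p)
  have "pcas (snd e) p v" "snd e \<in> S"
    using Cons.prems(1,2) Cons.prems(3)[of "fst e" "snd e"] by auto
  with Cons show ?case by auto
qed auto

lemma pcas_successor_closed_end:
  assumes "pcas u p v" "x \<in> fst ` set p" "x \<in> S" "\<And>x y. \<lbrakk>(x, y) \<in> set p; x \<in> S\<rbrakk> \<Longrightarrow> y \<in> S"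
  shows "v \<in> S"
  using assms
proof (induction p arbitrary: u)
  case (Cons e p)
  show ?case
  proof (cases "x = fst e")
    case True
    then show ?thesis using pcas_successor_closed[of u "e # p" v S] Cons.prems by auto
  next
    case False
    then show ?thesis using Cons by auto
  qed
qed auto

lemma closed_walk_subset_successor_closed:
  assumes "pcas u p u" "x \<in> fst ` set p" "x \<in> S" "\<And>x y. \<lbrakk>(x, y) \<in> set p; x \<in> S\<rbrakk> \<Longrightarrow> y \<in> S"
  shows "fst ` set p \<subseteq> S"
proof -
  have "u \<in> S" by (rule pcas_successor_closed_end[OF assms])
  then have "u \<in> S \<and> fst ` set p \<subseteq> S"
    by (rule pcas_successor_closed[OF assms(1)]) (rule assms(4))
  then show ?thesis by blast
qed

text \<open>
  On a cycle, the vertex that comes first in the elimination order has two cycle neighbours, and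
  both come later, so they are adjacent. As the cycle has at least four vertices, this edge does not
  belong to it.
\<close>

lemma perfect_elimination_order_chordal:
  fixes f :: "nat \<Rightarrow> 'b :: linorder"
  assumes G: "G \<in> graphs" and f: "inj_on f (pverts G)"
    and peo: "\<And>u v w. \<lbrakk>(u, v) \<in> parcs G; (u, w) \<in> parcs G; f u < f v; f u < f w; v \<noteq> w\<rbrakk>
      \<Longrightarrow> (v, w) \<in> parcs G"
  shows "G \<in> chordal_graphs"
proof -
  have "has_chord G p" if cyc: "pre_digraph.cycle (with_proj G) p" and len: "length p \<ge> 4" for p
  proof -
    obtain u where pA: "set p \<subseteq> parcs G" and cas: "pcas u p u"
      and dist: "distinct (tl (pawalk_verts u p))" and ne: "p \<noteq> []"
      using cyc by (auto simp: pre_digraph.cycle_def pre_digraph.awalk_def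
          cas_with_proj_eq awalk_verts_with_proj_eq)
    have ms: "map fst p @ [u] = u # map snd p" using pcas_map[OF cas] .
    have dsnd: "distinct (map snd p)" using dist pawalk_verts_map[OF cas] by simp
    have "mset (map fst p) + {#u#} = mset (map snd p) + {#u#}"
      using arg_cong[OF ms, of mset] by simp
    then have mseq: "mset (map fst p) = mset (map snd p)" by simp
    have dfst: "distinct (map fst p)" using dsnd mseq mset_eq_imp_distinct_iff by blast
    have seteq: "fst ` set p = snd ` set p" using mset_eq_setD[OF mseq] by simp
    have card: "card (fst ` set p) = length p" using distinct_card[OF dfst] by simp
    have vs: "fst ` set p \<subseteq> pverts G" using pA G by (auto simp: graphs_iff)
    have fin: "finite (f ` fst ` set p)" "f ` fst ` set p \<noteq> {}" using ne by auto
    from Min_in[OF fin] obtain x where x: "x \<in> fst ` set p" "f x = Min (f ` fst ` set p)"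
      by (metis imageE)
    have xmin: "f x \<le> f y" if "y \<in> fst ` set p" for y
      using x(2) that fin(1) by simp
    from x(1) obtain y where y: "(x, y) \<in> set p" by auto
    from x(1) obtain z where z: "(z, x) \<in> set p" using seteq by auto
    have succ: "b = c" if "(a, b) \<in> set p" "(a, c) \<in> set p" for a b c
      using dfst that inj_onD[of fst "set p" "(a, b)" "(a, c)"] by (simp add: distinct_map)
    have yz: "y \<in> fst ` set p" "z \<in> fst ` set p" using y z seteq by force+
    have loopless: "a \<noteq> b" if "(a, b) \<in> set p" for a b
      using that pA G by (auto simp: graphs_iff irrefl_def)
    have lt: "f x < f y" "f x < f z"
      using xmin[OF yz(1)] xmin[OF yz(2)] loopless[OF y] loopless[OF z] f x(1) yz vs
      by (metis inj_onD order_le_less subsetD)+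
    \<comment> \<open>A successor-closed set through \<open>x\<close> contains the whole cycle, which has at least four vertices.
      This excludes that \<open>x\<close> and its cycle neighbours form a closed walk of length two or three.\<close>
    have nclosed: False
      if S: "x \<in> S" "card S \<le> 3" "finite S" "\<And>a b. \<lbrakk>(a, b) \<in> set p; a \<in> S\<rbrakk> \<Longrightarrow> b \<in> S" for S
    proof -
      have "fst ` set p \<subseteq> S"
        using closed_walk_subset_successor_closed[OF cas x(1) S(1)] S(4) by blast
      then have "length p \<le> card S" using S(3) card card_mono by metis
      then show False using S(2) len by simp
    qed
    have "y \<noteq> z"
    proof
      assume "y = z"
      then have "b \<in> {x, y}" if "(a, b) \<in> set p" "a \<in> {x, y}" for a b
        using that y z succ by blast
      then show False by (intro nclosed[of "{x, y}"]) (auto simp: card_insert_if)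
    qed
    moreover have "(y, z) \<notin> set p"
    proof
      assume "(y, z) \<in> set p"
      then have "b \<in> {x, y, z}" if "(a, b) \<in> set p" "a \<in> {x, y, z}" for a b
        using that y z succ by blast
      then show False by (intro nclosed[of "{x, y, z}"]) (auto simp: card_insert_if)
    qed
    moreover have "(z, y) \<notin> set p" using succ[OF z] loopless[OF y] by auto
    moreover have "(x, y) \<in> parcs G" "(x, z) \<in> parcs G"
      using y z pA G by (auto simp: graphs_iff dest: symD)
    ultimately show ?thesis
      using peo[of x y z] lt yz unfolding has_chord_def by blast
  qed
  then show ?thesis using G by (auto simp: chordal_graphs_def)
qed

lemma chordless_cycle_not_chordal:
  assumes "u \<in> pverts G" "set p \<subseteq> parcs G" "pcas u p u" "distinct (map snd p)" "length p \<ge> 4"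
    "\<forall>a \<in> fst ` set p. \<forall>b \<in> fst ` set p. (a, b) \<in> parcs G \<longrightarrow> (a, b) \<in> set p \<or> (b, a) \<in> set p"
  shows "G \<notin> chordal_graphs"
proof -
  have "pre_digraph.cycle (with_proj G) p"
    using assms(1-5) pawalk_verts_map[OF assms(3)]
    by (auto simp: pre_digraph.cycle_def pre_digraph.awalk_def
          cas_with_proj_eq awalk_verts_with_proj_eq intro!: exI[of _ u])
  then show ?thesis using assms(5,6) by (auto simp: chordal_graphs_def has_chord_def)
qed

section \<open>Witnesses\<close>

abbreviation C4 :: "nat pair_pre_digraph" where
  "C4 \<equiv> sym_graph 4 {(0, 1), (2, 1), (2, 3), (0, 3)}"

abbreviation C5 :: "nat pair_pre_digraph" where
  "C5 \<equiv> sym_graph 5 {(0, 1), (1, 2), (2, 3), (3, 4), (4, 0)}"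

abbreviation C6 :: "nat pair_pre_digraph" where
  "C6 \<equiv> sym_graph 6 {(0, 1), (2, 1), (2, 3), (4, 3), (4, 5), (0, 5)}"

text \<open>
  The net is a triangle \<open>3, 4, 5\<close> with a pendant vertex attached to each corner.
\<close>

abbreviation net :: "nat pair_pre_digraph" where
  "net \<equiv> sym_graph 6 {(0, 3), (1, 4), (2, 5), (3, 4), (3, 5), (4, 5)}"

text \<open>
  The square of the path \<open>1, ..., 5\<close>, with a pendant vertex at each end. It is the intersection graph
  of the intervals \<open>[2,2], [0,3], [3,5], [3,6], [5,6], [6,7], [7,7]\<close>, listed by right endpoint.
\<close>

abbreviation tailed_path_square :: "nat pair_pre_digraph" where
  "tailed_path_square \<equiv> sym_graph 7
     {(0, 1), (1, 2), (1, 3), (2, 3), (2, 4), (3, 4), (3, 5), (4, 5), (5, 6)}"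

text \<open>
  The claw with centre \<open>6\<close>, each of its edges subdivided once. The leaves and the centre form one
  side of the bipartition, and the arcs leave that side.
\<close>

abbreviation spider :: "nat pair_pre_digraph" where
  "spider \<equiv> sym_graph 7 {(0, 3), (1, 4), (2, 5), (6, 3), (6, 4), (6, 5)}"

lemma witnesses_in_graphs:
  "C4 \<in> graphs" "C5 \<in> graphs" "C6 \<in> graphs" "net \<in> graphs" "tailed_path_square \<in> graphs"
  "spider \<in> graphs" "sym_graph 1 {} \<in> graphs"
  by (rule sym_graph_in_graphs; simp)+

lemma complement_sym_graph_eq:
  assumes "\<forall>u<n. \<forall>v<n. u \<noteq> v \<longrightarrow> (u, v) \<notin> D \<union> D\<inverse> \<longleftrightarrow> (u, v) \<in> D' \<union> D'\<inverse>"
    and "D' \<subseteq> {(u, v). u < n \<and> v < n \<and> u \<noteq> v}"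
  shows "complement (sym_graph n D) = sym_graph n D'"
proof (rule pair_pre_digraph.equality)
  have "(u, v) \<in> parcs (complement (sym_graph n D)) \<longleftrightarrow> (u, v) \<in> D' \<union> D'\<inverse>" for u v
  proof -
    have "(u, v) \<in> D' \<union> D'\<inverse> \<Longrightarrow> u < n \<and> v < n \<and> u \<noteq> v" using assms(2) by auto
    then show ?thesis using assms(1) unfolding parcs_complement by auto
  qed
  then show "parcs (complement (sym_graph n D)) = parcs (sym_graph n D')" by auto
qed simp_all

text \<open>
  Orienting a bipartite graph from one side to the other is transitive because no two arcs are in a
  row. This covers the four-cycle, the six-cycle and the subdivided claw.
\<close>

lemma C4_comparability: "C4 \<in> comparability_graphs"
  by (rule sym_graph_comparability) (simp_all, auto simp: trans_def)

lemma complement_C4_comparability: "complement C4 \<in> comparability_graphs"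
proof -
  have "complement C4 = sym_graph 4 {(0, 2), (1, 3)}"
    by (rule complement_sym_graph_eq) (auto simp: numeral_eq_Suc less_Suc_eq)
  moreover have "sym_graph 4 {(0, 2), (1, 3)} \<in> comparability_graphs"
    by (rule sym_graph_comparability) (simp_all, auto simp: trans_def)
  ultimately show ?thesis by simp
qed

lemma C4_not_chordal: "C4 \<notin> chordal_graphs"
  by (rule chordless_cycle_not_chordal[where u = 0 and p = "[(0, 1), (1, 2), (2, 3), (3, 0)]"]) simp_all

lemma C5_not_comparability: "C5 \<notin> comparability_graphs"
  by (rule odd_closed_walk_not_comparability[where u = 0 and v = 1 and p = "[2, 3, 4]"]) simp_all

lemma complement_C5_not_comparability: "complement C5 \<notin> comparability_graphs"
  by (rule odd_closed_walk_not_comparability[where u = 0 and v = 2 and p = "[4, 1, 3]"])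
    (simp_all add: parcs_complement)

lemma C5_not_chordal: "C5 \<notin> chordal_graphs"
  by (rule chordless_cycle_not_chordal[where u = 0
        and p = "[(0, 1), (1, 2), (2, 3), (3, 4), (4, 0)]"]) simp_all

lemma C6_comparability: "C6 \<in> comparability_graphs"
  by (rule sym_graph_comparability) (simp_all, auto simp: trans_def)

text \<open>
  Split the closed walk into its even and its odd positions. This shows two tokens that move in turn
  in \<open>C6\<close>, along an edge or not at all, never stand on the same or on adjacent vertices, and end with
  their places exchanged, because the length is odd. On the cycle they exchange places by running
  round in the same direction.
\<close>

lemma complement_C6_not_comparability: "complement C6 \<notin> comparability_graphs"
  by (rule odd_closed_walk_not_comparability[where u = 0 and v = 2 and p = "[5, 1, 4, 0, 3]"])
    (simp_all add: parcs_complement)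

lemma C6_not_chordal: "C6 \<notin> chordal_graphs"
  by (rule chordless_cycle_not_chordal[where u = 0
        and p = "[(0, 1), (1, 2), (2, 3), (3, 4), (4, 5), (5, 0)]"]) simp_all

text \<open>
  The complement of the six-cycle is a triangular prism, and the side faces of the prism are induced
  four-cycles.
\<close>

lemma complement_C6_not_chordal: "complement C6 \<notin> chordal_graphs"
  by (rule chordless_cycle_not_chordal[where u = 0 and p = "[(0, 2), (2, 5), (5, 3), (3, 0)]"])
    (simp_all add: parcs_complement)

text \<open>
  The vertices of the chordal witnesses are numbered along a perfect elimination order.
\<close>

lemma net_chordal: "net \<in> chordal_graphs"
  by (rule perfect_elimination_order_chordal[where f = id, OF witnesses_in_graphs(4)]) (simp, simp, elim disjE conjE, simp_all)

text \<open>
  The walk goes round the triangle and visits the pendant vertex at each corner, which separates the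
  consecutive triangle edges and makes the length \<open>3 + 2 * 3\<close> odd.
\<close>

lemma net_not_comparability: "net \<notin> comparability_graphs"
  by (rule odd_closed_walk_not_comparability[where u = 3 and v = 0
        and p = "[3, 4, 1, 4, 5, 2, 5]"]) simp_all

text \<open>
  In the net, two tokens on pendant vertices exchange places by using the third pendant vertex as a
  siding: one waits there until the other has passed. The subdivided claw has three branches that
  serve the same purpose.
\<close>

lemma complement_net_not_comparability: "complement net \<notin> comparability_graphs"
  by (rule odd_closed_walk_not_comparability[where u = 0 and v = 1
        and p = "[3, 1, 5, 1, 2, 4, 2, 3, 2, 0, 5, 0, 4]"])
    (simp_all add: parcs_complement)

lemma tailed_path_square_chordal: "tailed_path_square \<in> chordal_graphs"
  by (rule perfect_elimination_order_chordal[where f = id, OF witnesses_in_graphs(5)]) (simp, simp, elim disjE conjE, simp_all)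

lemma tailed_path_square_not_comparability: "tailed_path_square \<notin> comparability_graphs"
  by (rule odd_closed_walk_not_comparability[where u = 0 and v = 1
        and p = "[2, 4, 5, 6, 5, 3, 1]"]) simp_all

text \<open>
  Disjoint intervals are ordered from left to right. Since the vertices are listed by right
  endpoint, this orients each non-edge from the smaller to the larger number.
\<close>

lemma complement_tailed_path_square_comparability: "complement tailed_path_square \<in> comparability_graphs"
proof -
  let ?D = "{(0, 2), (0, 3), (0, 4), (0, 5), (0, 6), (1, 4), (1, 5), (1, 6), (2, 5), (2, 6),
    (3, 6), (4, 6)} :: (nat \<times> nat) set"
  have "complement tailed_path_square = sym_graph 7 ?D"
    by (rule complement_sym_graph_eq) (auto simp: numeral_eq_Suc less_Suc_eq)
  moreover have "trans ?D" by (auto simp: trans_def)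
  then have "sym_graph 7 ?D \<in> comparability_graphs"
    by (rule sym_graph_comparability[rotated 2]) simp_all
  ultimately show ?thesis by simp
qed

lemma spider_chordal: "spider \<in> chordal_graphs"
  by (rule perfect_elimination_order_chordal[where f = id, OF witnesses_in_graphs(6)]) (simp, simp, elim disjE conjE, simp_all)

lemma spider_comparability: "spider \<in> comparability_graphs"
  by (rule sym_graph_comparability) (simp_all, auto simp: trans_def)

lemma complement_spider_not_comparability: "complement spider \<notin> comparability_graphs"
  by (rule odd_closed_walk_not_comparability[where u = 6 and v = 0
        and p = "[4, 3, 1, 6, 1, 5, 4, 2, 6, 2, 3, 5, 0]"])
    (simp_all add: parcs_complement)

lemma one_vertex_graph:
  "sym_graph 1 {} \<in> chordal_graphs" "sym_graph 1 {} \<in> comparability_graphs"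
  "complement (sym_graph 1 {}) \<in> comparability_graphs"
proof -
  show "sym_graph 1 {} \<in> chordal_graphs"
    by (rule perfect_elimination_order_chordal[where f = id, OF witnesses_in_graphs(7)]) auto
  show c: "sym_graph 1 {} \<in> comparability_graphs"
    by (rule sym_graph_comparability) (simp_all add: trans_def)
  have "complement (sym_graph 1 {}) = sym_graph 1 {}"
    by (rule complement_sym_graph_eq) auto
  with c show "complement (sym_graph 1 {}) \<in> comparability_graphs" by simp
qed

theorem theorem3p16:
  shows "comparability_graphs - (competitivity_graphs \<union> chordal_graphs) \<noteq> {}
    \<and> competitivity_graphs - (comparability_graphs \<union> chordal_graphs) \<noteq> {}
    \<and> graphs - (comparability_graphs \<union> competitivity_graphs \<union> chordal_graphs) \<noteq> {}
    \<and> (permutation_graphs = comparability_graphs \<inter> competitivity_graphs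
        \<and> \<not> permutation_graphs \<subseteq> chordal_graphs)
    \<and> chordal_graphs - (comparability_graphs \<union> competitivity_graphs) \<noteq> {}
    \<and> competitivity_graphs \<inter> chordal_graphs \<inter> (graphs - comparability_graphs) \<noteq> {}
    \<and> comparability_graphs \<inter> chordal_graphs \<inter> (graphs - competitivity_graphs) \<noteq> {}
    \<and> chordal_graphs \<inter> competitivity_graphs \<inter> comparability_graphs \<noteq> {}"
proof (intro conjI)
  note cp = competitivity_iff_complement_comparability and g = witnesses_in_graphs
  have "C6 \<in> comparability_graphs - (competitivity_graphs \<union> chordal_graphs)"
    using C6_comparability complement_C6_not_comparability C6_not_chordal by (simp add: cp)
  then show "comparability_graphs - (competitivity_graphs \<union> chordal_graphs) \<noteq> {}" by blast
  have "complement C6 \<in> competitivity_graphs - (comparability_graphs \<union> chordal_graphs)"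
    using C6_comparability complement_C6_not_comparability complement_C6_not_chordal g(3)
    by (simp add: cp complement_in_graphs complement_complement)
  then show "competitivity_graphs - (comparability_graphs \<union> chordal_graphs) \<noteq> {}" by blast
  have "C5 \<in> graphs - (comparability_graphs \<union> competitivity_graphs \<union> chordal_graphs)"
    using C5_not_comparability complement_C5_not_comparability C5_not_chordal g(2)
    by (simp add: cp)
  then show "graphs - (comparability_graphs \<union> competitivity_graphs \<union> chordal_graphs) \<noteq> {}"
    by blast
  show "permutation_graphs = comparability_graphs \<inter> competitivity_graphs"
    by (rule permutation_eq_comparability_Int_competitivity)
  have "C4 \<in> permutation_graphs"
    using C4_comparability complement_C4_comparability
    by (rule comparability_and_complement_imp_permutation)
  then show "\<not> permutation_graphs \<subseteq> chordal_graphs" using C4_not_chordal by blast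
  have "net \<in> chordal_graphs - (comparability_graphs \<union> competitivity_graphs)"
    using net_chordal net_not_comparability complement_net_not_comparability by (simp add: cp)
  then show "chordal_graphs - (comparability_graphs \<union> competitivity_graphs) \<noteq> {}" by blast
  have "tailed_path_square \<in> competitivity_graphs \<inter> chordal_graphs \<inter> (graphs - comparability_graphs)"
    using tailed_path_square_chordal tailed_path_square_not_comparability
      complement_tailed_path_square_comparability g(5) by (simp add: cp)
  then show "competitivity_graphs \<inter> chordal_graphs \<inter> (graphs - comparability_graphs) \<noteq> {}"
    by blast
  have "spider \<in> comparability_graphs \<inter> chordal_graphs \<inter> (graphs - competitivity_graphs)"
    using spider_chordal spider_comparability complement_spider_not_comparability g(6)
    by (simp add: cp)
  then show "comparability_graphs \<inter> chordal_graphs \<inter> (graphs - competitivity_graphs) \<noteq> {}"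
    by blast
  have "sym_graph 1 {} \<in> chordal_graphs \<inter> competitivity_graphs \<inter> comparability_graphs"
    using one_vertex_graph g(7) cp by blast
  then show "chordal_graphs \<inter> competitivity_graphs \<inter> comparability_graphs \<noteq> {}" by blast
qed

end
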